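(* Let $n\ge1$ and let $X$ be a random vector in $\mathbb{R}^n$ with a log-concave density $f$. For every $t>0$, $$\mathbb{P}[\tilde h(X)-h(X)\leq -nt]\leq e^{-n r(-t)},$$ $$\mathbb{P}[\tilde h(X)-h(X)\geq nt]\leq e^{-n r(t)},$$ where $r(u)=u-\log(1+u)$ for $u>-1$ and $r(u)=+\infty$ for $u\le -1$.
   Context: A function $f:\mathbb{R}^n\to[0,\infty)$ is log-concave if $f=e^{-U}$ for some convex function $U:\mathbb{R}^n\to(-\infty,+\infty]$; a log-concave density is a probability density function (with respect to Lebesgue measure) that is log-concave. The information content of $X$ is the random variable $\tilde h(X)=-\log f(X)$, and the entropy is $h(X)=\mathbf{E}[\tilde h(X)]=-\int_{\mathbb{R}^n} f\log f$. The convention $e^{-\infty}=0$ is used. *)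

theory Defs
  imports "HOL-Probability.Probability"
begin

text \<open>The exponential on the extended real line; in particular \<open>e\<^sup>-\<^sup>\<infinity> = 0\<close>.\<close>

definition exp_ereal :: "ereal \<Rightarrow> ereal" where
  "exp_ereal a = (case a of ereal x \<Rightarrow> ereal (exp x) | PInfty \<Rightarrow> \<infinity> | MInfty \<Rightarrow> 0)"

lemma exp_ereal_simps [simp]:
  "exp_ereal (ereal x) = ereal (exp x)"
  "exp_ereal \<infinity> = \<infinity>"
  "exp_ereal (-\<infinity>) = 0"
  by (simp_all add: exp_ereal_def flip: infinity_ereal_def)

text \<open>Convexity of functions into \<open>(-\<infinity>, \<infinity>]\<close>. The library's \<^const>\<open>convex_on\<close> is not available for
  \<^typ>\<open>ereal\<close>-valued functions. The value \<open>-\<infinity>\<close> is excluded, so no \<open>\<infinity> - \<infinity>\<close> occurs; at the endpoints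
  of the segment, \<open>0 * \<infinity> = 0\<close> makes the inequality trivial.\<close>

definition convex_ereal :: "('a::real_vector \<Rightarrow> ereal) \<Rightarrow> bool" where
  "convex_ereal U \<longleftrightarrow>
     (\<forall>x. U x \<noteq> -\<infinity>) \<and>
     (\<forall>x y. \<forall>s\<in>{0..1}. U ((1 - s) *\<^sub>R x + s *\<^sub>R y) \<le> ereal (1 - s) * U x + ereal s * U y)"

text \<open>Nonnegativity of \<open>f\<close> is implied by the equation.\<close>

definition log_concave :: "('a::real_vector \<Rightarrow> real) \<Rightarrow> bool" where
  "log_concave f \<longleftrightarrow> (\<exists>U. convex_ereal U \<and> (\<forall>x. ereal (f x) = exp_ereal (- U x)))"

text \<open>The information content of a random vector \<open>X\<close> with density \<open>f\<close> is
  \<open>\<omega> \<mapsto> info_content f (X \<omega>)\<close>. The library's \<open>ln 0 = 0\<close> plays no role, since \<open>f (X \<omega>) > 0\<close>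
  almost surely.\<close>

definition info_content :: "('a \<Rightarrow> real) \<Rightarrow> 'a \<Rightarrow> real" where
  "info_content f x = - ln (f x)"

text \<open>As an expectation of the information content; the lemmas below give the equality with
  \<open>- \<integral> f ln f\<close> and with the library's entropy to base \<open>e\<close>.\<close>

definition diff_entropy :: "'b measure \<Rightarrow> ('b \<Rightarrow> 'a) \<Rightarrow> ('a \<Rightarrow> real) \<Rightarrow> real" where
  "diff_entropy M X f = (\<integral>\<omega>. info_content f (X \<omega>) \<partial>M)"

lemma diff_entropy_eq:
  fixes f :: "'a::euclidean_space \<Rightarrow> real"
  assumes X: "distributed M lborel X (\<lambda>x. ennreal (f x))" and f: "\<And>x. 0 \<le> f x"
  shows "diff_entropy M X f = - (\<integral>x. f x * ln (f x) \<partial>lborel)"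
proof -
  have "f \<in> borel_measurable lborel"
    using distributed_real_measurable[OF _ X] f by blast
  then have "(\<lambda>x. info_content f x) \<in> borel_measurable lborel"
    unfolding info_content_def by measurable
  from distributed_integral[OF X this] f show ?thesis
    by (simp add: diff_entropy_def info_content_def)
qed

lemma diff_entropy_eq_entropy:
  fixes f :: "'a::euclidean_space \<Rightarrow> real"
  assumes "prob_space M"
    and X: "distributed M lborel X (\<lambda>x. ennreal (f x))" and f: "\<And>x. 0 \<le> f x"
  shows "diff_entropy M X f = prob_space.entropy M (exp 1) lborel X"
proof -
  interpret prob_space M by fact
  interpret information_space M "exp 1" by unfold_locales simp
  show ?thesis
    by (simp add: diff_entropy_eq[OF X f] entropy_distr[OF X f] log_def)
qed

definition rate :: "real \<Rightarrow> ereal" where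
  "rate u = (if u > -1 then ereal (u - ln (1 + u)) else \<infinity>)"

end

theory Submission
  imports Defs
begin

text \<open>
  Write \<open>f = e\<^sup>-\<^sup>U\<close> with \<open>U\<close> convex on \<open>\<real>\<^sup>n\<close>, let \<open>h\<close> be the entropy, and put
  \<open>G a = a\<^sup>n \<integral> f\<^sup>a = \<integral> f(y/a)\<^sup>a dy\<close> for \<open>a > 0\<close>. The integrand on the right is \<open>exp (- a U(y/a))\<close>,
  and the perspective \<open>(y, a) \<mapsto> a U(y/a)\<close> of a convex function is jointly convex. By the
  Prekopa--Leindler inequality (\<open>prekopa_leindler\<close>) integrating out \<open>y\<close> preserves log-concavity,
  so \<open>G\<close> is log-concave (\<open>scaled_power_integral_log_concave\<close>), and \<open>G 1 = 1\<close>.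

  Consequently \<open>ln G\<close> lies below its tangent at \<open>1\<close>, whose slope is \<open>n - h\<close>:
  \<open>a\<^sup>n \<integral> f\<^sup>a \<le> exp ((a - 1) (n - h))\<close> (\<open>power_integral_upper_bound\<close>). Since \<open>\<integral> f\<^sup>a\<close> is the
  expectation of \<open>exp ((1 - a) (- ln f(X)))\<close>, Markov's inequality turns this into a bound on both
  tails of the information content in which \<open>h\<close> cancels (\<open>chernoff_bound\<close>): values \<open>a < 1\<close>
  give the upper tail, values \<open>a > 1\<close> the lower one. For a deviation by \<open>n u\<close> with \<open>u > -1\<close> the best
  choice is \<open>a = 1 / (1 + u)\<close>, and it produces exactly \<open>exp (- n (u - ln (1 + u)))\<close>. For \<open>u \<le> -1\<close>
  the bound tends to \<open>0\<close> as \<open>a \<rightarrow> \<infinity>\<close>.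

  The tangent inequality arises as a limit of chord inequalities. Log-concavity is
  applied to the three points \<open>a\<close>, \<open>1\<close> and \<open>b = 1 + (1 - a) / m\<close>; Jensen's inequality bounds
  \<open>\<integral> f\<^sup>b\<close> below by \<open>exp ((1 - b) h)\<close>; then \<open>m \<rightarrow> \<infinity>\<close>. The point \<open>1\<close> is a weighted mean of \<open>a\<close>
  and \<open>b\<close> with weights proportional to \<open>1\<close> and \<open>m\<close>. This is why the Prekopa--Leindler inequality is
  stated with natural number weights: raising everything to the power \<open>p + q\<close> leaves only powers
  with natural exponents, which behave well on \<^typ>\<open>ennreal\<close>, so that marginals with infinite values
  cause no difficulty. Finiteness of \<open>G\<close>, and with it the integrability of \<open>f ln f\<close>, is then a
  consequence of the log-concavity of \<open>G\<close>.
\<close>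

section \<open>The Brunn--Minkowski inequality on the line\<close>

lemma compact_inner_approximation:
  fixes A :: "'a::euclidean_space set"
  assumes [measurable]: "A \<in> sets borel" and c: "c < emeasure lborel A"
  obtains K where "compact K" "K \<subseteq> A" "c < emeasure lborel K"
proof -
  have "(\<lambda>k. emeasure lborel (A \<inter> cball 0 (real k))) \<longlonglongrightarrow> emeasure lborel (\<Union>k. A \<inter> cball 0 (real k))"
    by (intro Lim_emeasure_incseq) (auto simp: incseq_def)
  also have "(\<Union>k. A \<inter> cball 0 (real k)) = A"
    using real_arch_simple by auto
  finally have "\<forall>\<^sub>F k in sequentially. c < emeasure lborel (A \<inter> cball 0 (real k))"
    using c by (rule order_tendstoD(1))
  then obtain k where k: "c < emeasure lborel (A \<inter> cball 0 (real k))"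
    by (auto simp: eventually_sequentially)
  \<comment> \<open>Restricting to a bounded region yields a finite measure, for which inner regularity is available.\<close>
  define N where "N = density lborel (indicator (cball (0::'a) (real k)))"
  have em: "emeasure N B = emeasure lborel (B \<inter> cball 0 (real k))" if "B \<in> sets borel" for B
    using that unfolding N_def
    by (subst emeasure_density) (auto simp: Int_commute borel_measurable_indicator
        simp flip: indicator_inter_arith)
  have "emeasure N A = (SUP K\<in>{K. K \<subseteq> A \<and> compact K}. emeasure N K)"
  proof (rule inner_regular)
    show "sets N = sets borel" by (simp add: N_def)
    have "emeasure N UNIV = emeasure lborel (cball (0::'a) (real k))"
      using em[of UNIV] by simp
    moreover have "space N = UNIV" by (simp add: N_def)
    ultimately show "emeasure N (space N) \<noteq> \<infinity>"
      using emeasure_lborel_cball_finite[of "0::'a" "real k"] by simp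
  qed simp
  with k have "c < (SUP K\<in>{K. K \<subseteq> A \<and> compact K}. emeasure N K)"
    using em[of A] by simp
  then obtain K where K: "K \<subseteq> A" "compact K" "c < emeasure N K"
    by (auto simp: less_SUP_iff)
  show thesis
  proof (rule that[of "K \<inter> cball 0 (real k)"])
    show "c < emeasure lborel (K \<inter> cball 0 (real k))"
      using K em[of K] by (simp add: borel_compact)
  qed (use K in auto)
qed

lemma emeasure_lborel_translate:
  fixes A :: "'a::euclidean_space set"
  assumes "A \<in> sets borel"
  shows "(\<lambda>x. x - c) -` A \<in> sets borel" "emeasure lborel ((\<lambda>x. x - c) -` A) = emeasure lborel A"
proof -
  show "(\<lambda>x. x - c) -` A \<in> sets borel"
    using measurable_sets[of "\<lambda>x. x - c" borel borel A] assms by simp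
  have "emeasure lborel A = emeasure (distr lborel borel ((+) (- c))) A"
    by (simp only: lborel_distr_plus)
  also have "\<dots> = emeasure lborel ((\<lambda>x. x - c) -` A)"
    using assms by (subst emeasure_distr) (auto simp: vimage_def)
  finally show "emeasure lborel ((\<lambda>x. x - c) -` A) = emeasure lborel A" ..
qed

lemma emeasure_lborel_scale:
  fixes A :: "real set"
  assumes "A \<in> sets borel" "a > 0"
  shows "(\<lambda>x. x / a) -` A \<in> sets borel"
    "emeasure lborel ((\<lambda>x. x / a) -` A) = ennreal a * emeasure lborel A"
proof -
  show m: "(\<lambda>x. x / a) -` A \<in> sets borel"
    using measurable_sets[of "\<lambda>x. x / a" borel borel A] assms by simp
  have "emeasure lborel ((\<lambda>x. x / a) -` A) = (\<integral>\<^sup>+x. indicator ((\<lambda>x. x / a) -` A) x \<partial>lborel)"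
    using m by simp
  also have "\<dots> = ennreal \<bar>a\<bar> * (\<integral>\<^sup>+x. indicator ((\<lambda>x. x / a) -` A) (0 + a * x) \<partial>lborel)"
    using m assms by (intro nn_integral_real_affine) auto
  also have "(\<lambda>x. indicator ((\<lambda>x. x / a) -` A) (0 + a * x) :: ennreal) = indicator A"
    using assms by (auto simp: indicator_def)
  finally show "emeasure lborel ((\<lambda>x. x / a) -` A) = ennreal a * emeasure lborel A"
    using assms by simp
qed

text \<open>Translate \<open>K\<close> by the minimum \<open>b\<close> of \<open>L\<close> and \<open>L\<close> by the maximum \<open>a\<close> of \<open>K\<close>. Both translates lie in
  the Minkowski sum, one to the left and one to the right of \<open>a + b\<close>.\<close>

lemma brunn_minkowski_compact:
  fixes K L H :: "real set"
  assumes K: "compact K" "K \<noteq> {}" and L: "compact L" "L \<noteq> {}" and H: "H \<in> sets borel"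
    and sub: "\<And>x y. x \<in> K \<Longrightarrow> y \<in> L \<Longrightarrow> x + y \<in> H"
  shows "emeasure lborel K + emeasure lborel L \<le> emeasure lborel H"
proof -
  obtain a where a: "a \<in> K" "\<And>x. x \<in> K \<Longrightarrow> x \<le> a"
    using compact_attains_sup[OF K] by blast
  obtain b where b: "b \<in> L" "\<And>y. y \<in> L \<Longrightarrow> b \<le> y"
    using compact_attains_inf[OF L] by blast
  have [measurable]: "K \<in> sets borel" "L \<in> sets borel"
    using K L by (auto intro: borel_compact)
  define K' where "K' = (\<lambda>x. x - b) -` K"
  define L' where "L' = (\<lambda>x. x - a) -` (L - {b})"
  have [measurable]: "K' \<in> sets borel" "L' \<in> sets borel"
    unfolding K'_def L'_def by (auto intro!: emeasure_lborel_translate(1))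
  have "emeasure lborel (L - {b}) = emeasure lborel L"
    by (intro emeasure_Diff_null_set) auto
  then have "emeasure lborel K + emeasure lborel L = emeasure lborel K' + emeasure lborel L'"
    unfolding K'_def L'_def by (simp add: emeasure_lborel_translate(2))
  also have "K' \<inter> L' = {}"
    using a b by (fastforce simp: K'_def L'_def)
  then have "emeasure lborel K' + emeasure lborel L' = emeasure lborel (K' \<union> L')"
    by (intro plus_emeasure) auto
  also have "\<dots> \<le> emeasure lborel H"
  proof (rule emeasure_mono)
    show "K' \<union> L' \<subseteq> H"
      using sub[OF _ b(1)] sub[OF a(1)] by (fastforce simp: K'_def L'_def)
  qed (use H in simp)
  finally show ?thesis .
qed

text \<open>The one-dimensional Brunn--Minkowski inequality, by compact approximation from inside. The set \<open>H\<close> stands for a measurable superset of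
  \<open>A + B\<close>, since the sum of two Borel sets need not be Borel.\<close>

lemma brunn_minkowski_real:
  fixes A B H :: "real set"
  assumes A: "A \<in> sets borel" "A \<noteq> {}" and B: "B \<in> sets borel" "B \<noteq> {}" and H: "H \<in> sets borel"
    and sub: "\<And>x y. x \<in> A \<Longrightarrow> y \<in> B \<Longrightarrow> x + y \<in> H"
  shows "emeasure lborel A + emeasure lborel B \<le> emeasure lborel H"
proof -
  \<comment> \<open>The alternative \<open>c = 0\<close> covers null sets, which still need a nonempty compact subset.\<close>
  have *: "\<exists>K. compact K \<and> K \<noteq> {} \<and> K \<subseteq> S \<and> c \<le> emeasure lborel K"
    if S: "c < emeasure lborel S \<or> c = 0" "S \<in> sets borel" "S \<noteq> {}" for S :: "real set" and c
  proof (cases "c = 0")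
    case True
    then show ?thesis using S(3) by (auto intro!: exI[of _ "{SOME x. x \<in> S}"] simp: some_in_eq)
  next
    case False
    then obtain K where "compact K" "K \<subseteq> S" "c < emeasure lborel K"
      using compact_inner_approximation[OF S(2)] S(1) by blast
    then show ?thesis by (intro exI[of _ K]) auto
  qed
  have le: "c + d \<le> emeasure lborel H"
    if c: "c < emeasure lborel A \<or> c = 0" and d: "d < emeasure lborel B \<or> d = 0" for c d
  proof -
    obtain K L where "compact K" "K \<noteq> {}" "K \<subseteq> A" "c \<le> emeasure lborel K"
        "compact L" "L \<noteq> {}" "L \<subseteq> B" "d \<le> emeasure lborel L"
      using *[OF c A] *[OF d B] by blast
    then show ?thesis
      using brunn_minkowski_compact[of K L H] H sub by (meson add_mono order_trans subsetD)
  qed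
  have le': "emeasure lborel A + d \<le> emeasure lborel H"
    if d: "d < emeasure lborel B \<or> d = 0" for d
  proof (cases "emeasure lborel A = 0")
    case False
    have "emeasure lborel A + d = (SUP c\<in>{..<emeasure lborel A}. c) + d"
      by (simp add: Sup_lessThan)
    also have "\<dots> = (SUP c\<in>{..<emeasure lborel A}. c + d)"
      using False by (intro ennreal_SUP_add_left[symmetric]) (metis lessThan_iff empty_iff zero_less_iff_neq_zero)
    also have "\<dots> \<le> emeasure lborel H"
      using le[OF _ d] by (auto intro!: SUP_least)
    finally show ?thesis .
  qed (use le[OF _ d, of 0] in simp)
  show ?thesis
  proof (cases "emeasure lborel B = 0")
    case False
    have "emeasure lborel A + emeasure lborel B = emeasure lborel A + (SUP d\<in>{..<emeasure lborel B}. d)"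
      by (simp add: Sup_lessThan)
    also have "\<dots> = (SUP d\<in>{..<emeasure lborel B}. emeasure lborel A + d)"
      using False by (intro ennreal_SUP_add_right) (metis lessThan_iff empty_iff zero_less_iff_neq_zero)
    also have "\<dots> \<le> emeasure lborel H"
      using le' by (auto intro!: SUP_least)
    finally show ?thesis .
  qed (use le'[of 0] in simp)
qed

section \<open>The Prekopa--Leindler inequality\<close>

text \<open>For functions bounded by \<open>1\<close> only the levels in \<open>{0..<1}\<close> contribute. On these levels the
  superlevel sets of a function with supremum \<open>1\<close> are nonempty, as Brunn--Minkowski demands.\<close>

lemma layer_cake_unit:
  fixes f :: "real \<Rightarrow> ennreal"
  assumes [measurable]: "f \<in> borel_measurable borel" and f: "\<And>x. f x \<le> 1"
  shows "(\<integral>\<^sup>+x. f x \<partial>lborel) = (\<integral>\<^sup>+t. emeasure lborel {x. ennreal t < f x} * indicator {0..<1} t \<partial>lborel)"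
proof -
  have level: "f x = (\<integral>\<^sup>+t. indicator {x. ennreal t < f x} x * indicator {0..<1} t \<partial>lborel)" for x
  proof -
    obtain r where r: "f x = ennreal r" "0 \<le> r" "r \<le> 1"
      using f[of x] by (cases "f x") (auto simp: ennreal_le_1 top_unique)
    have "(\<integral>\<^sup>+t. indicator {x. ennreal t < f x} x * indicator {0..<1} t \<partial>lborel)
        = (\<integral>\<^sup>+t. indicator {0..<r} t \<partial>lborel)"
      using r by (intro nn_integral_cong) (auto simp: indicator_def ennreal_less_iff)
    also have "\<dots> = f x" using r by simp
    finally show ?thesis ..
  qed
  have "(\<integral>\<^sup>+x. f x \<partial>lborel)
      = (\<integral>\<^sup>+x. (\<integral>\<^sup>+t. indicator {x. ennreal t < f x} x * indicator {0..<1} t \<partial>lborel) \<partial>lborel)"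
    by (intro nn_integral_cong level)
  also have "\<dots> = (\<integral>\<^sup>+t. (\<integral>\<^sup>+x. indicator {x. ennreal t < f x} x * indicator {0..<1} t \<partial>lborel) \<partial>lborel)"
    by (rule lborel_pair.Fubini') measurable
  also have "\<dots> = (\<integral>\<^sup>+t. emeasure lborel {x. ennreal t < f x} * indicator {0..<1} t \<partial>lborel)"
    by (simp add: nn_integral_multc)
  finally show ?thesis .
qed

text \<open>The hypothesis says that each superlevel set of \<open>h\<close> contains the corresponding Minkowski
  combination of superlevel sets of \<open>f\<close> and \<open>g\<close>; apply Brunn--Minkowski level by level and integrate
  over the levels. Equal suprema matter: they make the superlevel sets of \<open>f\<close> and \<open>g\<close> nonempty for the
  same range of levels.\<close>

lemma integral_superlevel_sum:
  fixes f g h :: "real \<Rightarrow> ennreal"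
  assumes [measurable]: "f \<in> borel_measurable borel" "g \<in> borel_measurable borel"
      "h \<in> borel_measurable borel"
    and f: "\<And>x. f x \<le> 1" "(SUP x. f x) = 1" and g: "\<And>x. g x \<le> 1" "(SUP x. g x) = 1"
    and ab: "0 < a" "0 < b"
    and sup: "\<And>x y t. \<lbrakk>0 \<le> t; t < 1; ennreal t < f x; ennreal t < g y\<rbrakk> \<Longrightarrow> ennreal t < h (a * x + b * y)"
  shows "ennreal a * (\<integral>\<^sup>+x. f x \<partial>lborel) + ennreal b * (\<integral>\<^sup>+x. g x \<partial>lborel) \<le> (\<integral>\<^sup>+x. h x \<partial>lborel)"
proof -
  \<comment> \<open>The function \<open>h\<close> may exceed \<open>1\<close>; cutting it off does not affect the levels below \<open>1\<close>.\<close>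
  define k where "k x = min (h x) 1" for x
  have [measurable]: "k \<in> borel_measurable borel" unfolding k_def by measurable
  have level: "ennreal a * emeasure lborel {x. ennreal t < f x} + ennreal b * emeasure lborel {x. ennreal t < g x}
      \<le> emeasure lborel {x. ennreal t < k x}" if t: "0 \<le> t" "t < 1" for t
  proof -
    let ?A = "(\<lambda>x. x / a) -` {x. ennreal t < f x}" and ?B = "(\<lambda>x. x / b) -` {x. ennreal t < g x}"
    have t1: "ennreal t < 1" using t by (simp add: ennreal_less_iff flip: ennreal_1)
    obtain x y where "ennreal t < f x" "ennreal t < g y"
      using t1 f(2) g(2) by (metis less_SUP_iff UNIV_I)
    then have "a * x \<in> ?A" "b * y \<in> ?B" using ab by auto
    then have ne: "?A \<noteq> {}" "?B \<noteq> {}" by blast+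
    have "emeasure lborel ?A + emeasure lborel ?B \<le> emeasure lborel {x. ennreal t < k x}"
    proof (rule brunn_minkowski_real)
      fix x y assume "x \<in> ?A" "y \<in> ?B"
      then show "x + y \<in> {x. ennreal t < k x}"
        using sup[OF t, of "x / a" "y / b"] ab t1 by (simp add: k_def)
    qed (use ne in \<open>simp_all add: emeasure_lborel_scale(1) ab\<close>)
    moreover have "emeasure lborel ?A = ennreal a * emeasure lborel {x. ennreal t < f x}"
        "emeasure lborel ?B = ennreal b * emeasure lborel {x. ennreal t < g x}"
      using ab by (intro emeasure_lborel_scale(2); simp)+
    ultimately show ?thesis by simp
  qed
  have "ennreal a * (\<integral>\<^sup>+x. f x \<partial>lborel) + ennreal b * (\<integral>\<^sup>+x. g x \<partial>lborel)
     = (\<integral>\<^sup>+t. (ennreal a * emeasure lborel {x. ennreal t < f x}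
         + ennreal b * emeasure lborel {x. ennreal t < g x}) * indicator {0..<1} t \<partial>lborel)"
    by (simp add: layer_cake_unit f(1) g(1) distrib_right mult.assoc nn_integral_add nn_integral_cmult)
  also have "\<dots> \<le> (\<integral>\<^sup>+t. emeasure lborel {x. ennreal t < k x} * indicator {0..<1} t \<partial>lborel)"
    using level by (intro nn_integral_mono) (auto simp: indicator_def)
  also have "\<dots> = (\<integral>\<^sup>+x. k x \<partial>lborel)"
    by (rule layer_cake_unit[symmetric]) (auto simp: k_def)
  also have "\<dots> \<le> (\<integral>\<^sup>+x. h x \<partial>lborel)"
    by (intro nn_integral_mono) (simp add: k_def)
  finally show ?thesis .
qed

lemma weighted_am_gm_ennreal:
  fixes u v :: ennreal
  assumes pq: "0 < p" "0 < q"
  shows "u ^ p * v ^ q \<le> (ennreal (real p / real (p + q)) * u + ennreal (real q / real (p + q)) * v) ^ (p + q)"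
proof (cases "u = \<infinity> \<or> v = \<infinity>")
  case True
  then have "ennreal (real p / real (p + q)) * u + ennreal (real q / real (p + q)) * v = \<infinity>"
    using pq by (auto simp: ennreal_mult_top)
  moreover have "(\<infinity> :: ennreal) ^ (p + q) = \<infinity>" using pq by simp
  ultimately show ?thesis by (simp only: infinity_ennreal_def top_greatest)
next
  case False
  then obtain x y where u: "u = ennreal x" "0 \<le> x" and v: "v = ennreal y" "0 \<le> y"
    by (metis ennreal_cases infinity_ennreal_def)
  show ?thesis
  proof (cases "x = 0 \<or> y = 0")
    case True
    then show ?thesis using pq u v by (auto simp: power_0_left)
  next
    case False
    let ?n = "p + q"
    let ?a = "real p / real ?n" and ?b = "real q / real ?n"
    have "x powr ?a * y powr ?b \<le> ?a * x + ?b * y"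
      using False u v pq by (intro Youngs_inequality_0) (simp_all flip: add_divide_distrib)
    then have "(x powr ?a * y powr ?b) ^ ?n \<le> (?a * x + ?b * y) ^ ?n"
      by (intro power_mono) auto
    also have "(x powr ?a * y powr ?b) ^ ?n = x ^ p * y ^ q"
    proof -
      have "(z powr (real k / real ?n)) ^ ?n = z ^ k" if "0 < z" for z :: real and k
        using that pq by (subst powr_realpow[symmetric]) (simp_all add: powr_powr powr_realpow del: of_nat_add)
      then have "(x powr ?a) ^ ?n = x ^ p" "(y powr ?b) ^ ?n = y ^ q"
        using False u v by simp_all
      then show ?thesis by (simp only: power_mult_distrib)
    qed
    finally show ?thesis using u v
      by (simp add: ennreal_power flip: ennreal_mult ennreal_plus)
  qed
qed

text \<open>Bounded functions can be rescaled to have supremum \<open>1\<close>. After rescaling, the superlevel sets give a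
  bound by the weighted arithmetic mean of the integrals, which dominates the geometric mean.\<close>

lemma prekopa_leindler_real_bounded:
  fixes f g h :: "real \<Rightarrow> ennreal"
  assumes [measurable]: "f \<in> borel_measurable borel" "g \<in> borel_measurable borel"
      "h \<in> borel_measurable borel"
    and pq: "0 < p" "0 < q"
    and bdd: "B \<noteq> \<infinity>" "\<And>x. f x \<le> B" "\<And>x. g x \<le> B"
    and ineq: "\<And>x y. f x ^ p * g y ^ q \<le> h ((real p * x + real q * y) / real (p + q)) ^ (p + q)"
  shows "(\<integral>\<^sup>+x. f x \<partial>lborel) ^ p * (\<integral>\<^sup>+x. g x \<partial>lborel) ^ q \<le> (\<integral>\<^sup>+x. h x \<partial>lborel) ^ (p + q)"
proof (cases "(SUP x. f x) = 0 \<or> (SUP x. g x) = 0")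
  case True
  then have "(\<forall>x. f x = 0) \<or> (\<forall>x. g x = 0)"
    by (simp add: SUP_eq_iff[where c = 0] flip: bot_ennreal)
  then show ?thesis
    using pq by (auto simp: power_0_left)
next
  case False
  have "(SUP x. f x) \<le> B" "(SUP x. g x) \<le> B" using bdd by (auto intro: SUP_least)
  with bdd(1) False obtain m n where m: "(SUP x. f x) = ennreal m" "0 < m"
      and n: "(SUP x. g x) = ennreal n" "0 < n"
    by (metis ennreal_cases ennreal_0 infinity_ennreal_def less_eq_real_def top.extremum_uniqueI)
  \<comment> \<open>The scale of \<open>h\<close> is the weighted geometric mean of the scales of \<open>f\<close> and \<open>g\<close>.\<close>
  define c where "c = root (p + q) (m ^ p * n ^ q)"
  have c: "0 < c" "c ^ (p + q) = m ^ p * n ^ q"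
    using m n pq by (auto simp: c_def)
  define f1 where "f1 x = ennreal (1 / m) * f x" for x
  define g1 where "g1 x = ennreal (1 / n) * g x" for x
  define h1 where "h1 x = ennreal (1 / c) * h x" for x
  have [measurable]: "f1 \<in> borel_measurable borel" "g1 \<in> borel_measurable borel"
      "h1 \<in> borel_measurable borel"
    unfolding f1_def g1_def h1_def by measurable
  have sup1: "(SUP x. f1 x) = 1" "(SUP x. g1 x) = 1"
    using m n by (simp_all add: f1_def g1_def flip: SUP_mult_left_ennreal ennreal_mult)
  have le1: "f1 x \<le> 1" "g1 x \<le> 1" for x
    using SUP_upper[of x UNIV f1] SUP_upper[of x UNIV g1] sup1 by auto
  have scale: "f x = ennreal m * f1 x" "g x = ennreal n * g1 x" "h x = ennreal c * h1 x" for x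
    using m n c by (simp_all add: f1_def g1_def h1_def flip: mult.assoc ennreal_mult)
  have const: "(ennreal m * u) ^ p * (ennreal n * v) ^ q = ennreal c ^ (p + q) * (u ^ p * v ^ q)" for u v
  proof -
    have "ennreal m ^ p * ennreal n ^ q = ennreal c ^ (p + q)"
      using m n c by (simp add: ennreal_power flip: ennreal_mult)
    then show ?thesis by (simp add: power_mult_distrib mult_ac)
  qed
  have cancel: "u \<le> v" if "ennreal c ^ (p + q) * u \<le> ennreal c ^ (p + q) * v" for u v
  proof -
    have "ennreal c ^ (p + q) \<noteq> 0" "ennreal c ^ (p + q) \<noteq> \<infinity>"
      using c(1) by (simp_all add: power_eq_top_ennreal)
    with that show ?thesis by (simp add: ennreal_mult_le_mult_iff)
  qed
  have ineq1: "f1 x ^ p * g1 y ^ q \<le> h1 ((real p * x + real q * y) / real (p + q)) ^ (p + q)" for x y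
    using ineq[of x y] unfolding scale const power_mult_distrib[of "ennreal c"] by (rule cancel)
  let ?a = "real p / real (p + q)" and ?b = "real q / real (p + q)"
  have "ennreal ?a * (\<integral>\<^sup>+x. f1 x \<partial>lborel) + ennreal ?b * (\<integral>\<^sup>+x. g1 x \<partial>lborel) \<le> (\<integral>\<^sup>+x. h1 x \<partial>lborel)"
  proof (rule integral_superlevel_sum)
    fix x y t :: real assume t: "0 \<le> t" "t < 1" and x: "ennreal t < f1 x" and y: "ennreal t < g1 y"
    obtain u v where u: "f1 x = ennreal u" "0 \<le> u" and v: "g1 y = ennreal v" "0 \<le> v"
      using le1 by (metis ennreal_cases ennreal_one_neq_top top.extremum_uniqueI)
    have "t < u" "t < v" using x y u v t by (auto simp: ennreal_less_iff)
    then have "t ^ p * t ^ q < u ^ p * v ^ q"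
      using pq t by (intro mult_strict_mono' power_strict_mono) auto
    then have "ennreal t ^ (p + q) < f1 x ^ p * g1 y ^ q"
      using t u v by (simp add: ennreal_power power_add ennreal_less_iff flip: ennreal_mult)
    also note ineq1
    finally have "ennreal t < h1 ((real p * x + real q * y) / real (p + q))"
      by (meson not_less power_mono_ennreal)
    then show "ennreal t < h1 (?a * x + ?b * y)"
      by (simp add: add_divide_distrib)
  qed (use pq sup1 le1 in auto)
  then have "(ennreal ?a * (\<integral>\<^sup>+x. f1 x \<partial>lborel) + ennreal ?b * (\<integral>\<^sup>+x. g1 x \<partial>lborel)) ^ (p + q)
      \<le> (\<integral>\<^sup>+x. h1 x \<partial>lborel) ^ (p + q)"
    by (rule power_mono_ennreal)
  with weighted_am_gm_ennreal[OF pq]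
  have "(\<integral>\<^sup>+x. f1 x \<partial>lborel) ^ p * (\<integral>\<^sup>+x. g1 x \<partial>lborel) ^ q \<le> (\<integral>\<^sup>+x. h1 x \<partial>lborel) ^ (p + q)"
    by (rule order_trans)
  then show ?thesis
    unfolding scale by (simp add: nn_integral_cmult const power_mult_distrib[of "ennreal c"] mult_left_mono)
qed

lemma tendsto_power_ennreal:
  fixes u :: "nat \<Rightarrow> ennreal"
  assumes "u \<longlonglongrightarrow> l"
  shows "(\<lambda>k. u k ^ n) \<longlonglongrightarrow> l ^ n"
proof (induction n)
  case (Suc n)
  have "(\<lambda>k. u k * u k ^ n) \<longlonglongrightarrow> l * l ^ n"
    by (intro tendsto_mult_ennreal assms Suc) (auto simp: power_eq_top_ennreal)
  then show ?case by simp
qed simp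

lemma nn_integral_truncation_tendsto:
  assumes [measurable]: "f \<in> borel_measurable M"
  shows "(\<lambda>k. \<integral>\<^sup>+x. inf (f x) (of_nat k) \<partial>M) \<longlonglongrightarrow> (\<integral>\<^sup>+x. f x \<partial>M)"
proof -
  have inc: "incseq (\<lambda>k x. inf (f x) (of_nat k))"
    by (auto simp: incseq_def le_fun_def intro: le_infI2)
  have "(\<integral>\<^sup>+x. f x \<partial>M) = (\<integral>\<^sup>+x. (SUP k. inf (f x) (of_nat k)) \<partial>M)"
    by (simp add: ennreal_SUP_of_nat_eq_top flip: inf_SUP)
  also have "\<dots> = (SUP k. \<integral>\<^sup>+x. inf (f x) (of_nat k) \<partial>M)"
    using inc by (rule nn_integral_monotone_convergence_SUP) (simp add: inf_min)
  finally show ?thesis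
    using inc by (auto intro!: LIMSEQ_SUP nn_integral_mono simp: incseq_def le_fun_def)
qed

lemma prekopa_leindler_real:
  fixes f g h :: "real \<Rightarrow> ennreal"
  assumes [measurable]: "f \<in> borel_measurable borel" "g \<in> borel_measurable borel"
      "h \<in> borel_measurable borel"
    and pq: "0 < p" "0 < q"
    and ineq: "\<And>x y. f x ^ p * g y ^ q \<le> h ((real p * x + real q * y) / real (p + q)) ^ (p + q)"
  shows "(\<integral>\<^sup>+x. f x \<partial>lborel) ^ p * (\<integral>\<^sup>+x. g x \<partial>lborel) ^ q \<le> (\<integral>\<^sup>+x. h x \<partial>lborel) ^ (p + q)"
proof (cases "(\<integral>\<^sup>+x. f x \<partial>lborel) = 0 \<or> (\<integral>\<^sup>+x. g x \<partial>lborel) = 0")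
  case True
  then show ?thesis using pq by (auto simp: power_0_left)
next
  case False
  let ?F = "\<lambda>k. \<integral>\<^sup>+x. inf (f x) (of_nat k) \<partial>lborel" and ?G = "\<lambda>k. \<integral>\<^sup>+x. inf (g x) (of_nat k) \<partial>lborel"
  have "(\<lambda>k. ?F k ^ p * ?G k ^ q) \<longlonglongrightarrow> (\<integral>\<^sup>+x. f x \<partial>lborel) ^ p * (\<integral>\<^sup>+x. g x \<partial>lborel) ^ q"
    using False by (intro tendsto_mult_ennreal tendsto_power_ennreal nn_integral_truncation_tendsto) auto
  moreover have "?F k ^ p * ?G k ^ q \<le> (\<integral>\<^sup>+x. h x \<partial>lborel) ^ (p + q)" for k
  proof (rule prekopa_leindler_real_bounded[where B = "of_nat k"])
    fix x y
    have "inf (f x) (of_nat k) ^ p * inf (g y) (of_nat k) ^ q \<le> f x ^ p * g y ^ q"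
      by (intro mult_mono power_mono_ennreal) auto
    also note ineq
    finally show "inf (f x) (of_nat k) ^ p * inf (g y) (of_nat k) ^ q
        \<le> h ((real p * x + real q * y) / real (p + q)) ^ (p + q)" .
  qed (use pq in \<open>auto simp: inf_min\<close>)
  ultimately show ?thesis
    by (intro LIMSEQ_le_const2) auto
qed

text \<open>Induction over the coordinates: for fixed remaining coordinates the one-dimensional inequality,
  applied to the sections, shows that the marginals again satisfy the hypothesis.\<close>

lemma prekopa_leindler_PiM:
  fixes f g h :: "('i \<Rightarrow> real) \<Rightarrow> ennreal"
  assumes "finite I"
    and "f \<in> borel_measurable (Pi\<^sub>M I (\<lambda>_. lborel))" "g \<in> borel_measurable (Pi\<^sub>M I (\<lambda>_. lborel))"
      "h \<in> borel_measurable (Pi\<^sub>M I (\<lambda>_. lborel))"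
    and pq: "0 < p" "0 < q"
    and "\<And>x y. x \<in> space (Pi\<^sub>M I (\<lambda>_. lborel)) \<Longrightarrow> y \<in> space (Pi\<^sub>M I (\<lambda>_. lborel)) \<Longrightarrow>
      f x ^ p * g y ^ q \<le> h (\<lambda>i\<in>I. (real p * x i + real q * y i) / real (p + q)) ^ (p + q)"
  shows "(\<integral>\<^sup>+x. f x \<partial>Pi\<^sub>M I (\<lambda>_. lborel)) ^ p * (\<integral>\<^sup>+x. g x \<partial>Pi\<^sub>M I (\<lambda>_. lborel)) ^ q \<le> (\<integral>\<^sup>+x. h x \<partial>Pi\<^sub>M I (\<lambda>_. lborel)) ^ (p + q)"
  using assms(1-4,7)
proof (induction I arbitrary: f g h rule: finite_induct)
  case empty
  interpret product_sigma_finite "\<lambda>_ :: 'i. lborel :: real measure" ..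
  show ?case
    using empty.prems(4)[of "\<lambda>_. undefined" "\<lambda>_. undefined"]
    by (simp add: nn_integral_empty space_PiM restrict_def)
next
  case (insert i I)
  interpret product_sigma_finite "\<lambda>_ :: 'i. lborel :: real measure" ..
  let ?c = "\<lambda>u v. (real p * u + real q * v) / real (p + q)"
  note [measurable] = insert.prems(1-3)
  have section_meas: "(\<lambda>t. k (x(i := t))) \<in> borel_measurable borel"
    if "k \<in> borel_measurable (Pi\<^sub>M (insert i I) (\<lambda>_. lborel))" "x \<in> space (Pi\<^sub>M I (\<lambda>_. lborel))"
    for k :: "('i \<Rightarrow> real) \<Rightarrow> ennreal" and x
  proof -
    have "(\<lambda>t. x(i := t)) \<in> lborel \<rightarrow>\<^sub>M Pi\<^sub>M (insert i I) (\<lambda>_. lborel)"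
      using measurable_component_update[OF that(2) insert.hyps(2)] .
    from measurable_compose[OF this that(1)] show ?thesis by simp
  qed
  have marginal_meas: "(\<lambda>x. \<integral>\<^sup>+t. k (x(i := t)) \<partial>lborel) \<in> borel_measurable (Pi\<^sub>M I (\<lambda>_. lborel))"
    if "k \<in> borel_measurable (Pi\<^sub>M (insert i I) (\<lambda>_. lborel))" for k :: "('i \<Rightarrow> real) \<Rightarrow> ennreal"
    using measurable_compose[OF measurable_add_dim that]
    by (intro lborel.borel_measurable_nn_integral) (simp add: split_def)
  have "(\<integral>\<^sup>+x. (\<integral>\<^sup>+t. f (x(i := t)) \<partial>lborel) \<partial>Pi\<^sub>M I (\<lambda>_. lborel)) ^ p * (\<integral>\<^sup>+x. (\<integral>\<^sup>+t. g (x(i := t)) \<partial>lborel) \<partial>Pi\<^sub>M I (\<lambda>_. lborel)) ^ q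
      \<le> (\<integral>\<^sup>+x. (\<integral>\<^sup>+t. h (x(i := t)) \<partial>lborel) \<partial>Pi\<^sub>M I (\<lambda>_. lborel)) ^ (p + q)"
  proof (rule insert.IH)
    fix x y :: "'i \<Rightarrow> real" assume x: "x \<in> space (Pi\<^sub>M I (\<lambda>_. lborel))" and y: "y \<in> space (Pi\<^sub>M I (\<lambda>_. lborel))"
    define z where "z = (\<lambda>j\<in>I. ?c (x j) (y j))"
    have z: "z \<in> space (Pi\<^sub>M I (\<lambda>_. lborel))" by (auto simp: z_def space_PiM)
    show "(\<integral>\<^sup>+t. f (x(i := t)) \<partial>lborel) ^ p * (\<integral>\<^sup>+t. g (y(i := t)) \<partial>lborel) ^ q
        \<le> (\<integral>\<^sup>+t. h (z(i := t)) \<partial>lborel) ^ (p + q)"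
          proof (rule prekopa_leindler_real)
      fix u v :: real
      have "(\<lambda>j\<in>insert i I. ?c ((x(i := u)) j) ((y(i := v)) j)) = z(i := ?c u v)"
        using insert.hyps(2) by (auto simp: z_def fun_eq_iff)
      moreover have "x(i := u) \<in> space (Pi\<^sub>M (insert i I) (\<lambda>_. lborel))" "y(i := v) \<in> space (Pi\<^sub>M (insert i I) (\<lambda>_. lborel))"
        using x y by (auto simp: space_PiM PiE_def extensional_def)
      ultimately show "f (x(i := u)) ^ p * g (y(i := v)) ^ q \<le> h (z(i := ?c u v)) ^ (p + q)"
        using insert.prems(4)[of "x(i := u)" "y(i := v)"] by (simp only:)
    qed (use x y z pq section_meas insert.prems(1-3) in auto)
  qed (rule marginal_meas, fact)+
  then show ?case
    using insert.hyps insert.prems(1-3) by (simp add: product_nn_integral_insert)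
qed

text \<open>Lebesgue measure is the image of the product measure under a linear map, which respects the
  weighted mean in the hypothesis.\<close>

lemma prekopa_leindler:
  fixes f g h :: "'a::euclidean_space \<Rightarrow> ennreal"
  assumes [measurable]: "f \<in> borel_measurable borel" "g \<in> borel_measurable borel"
      "h \<in> borel_measurable borel"
    and pq: "0 < p" "0 < q"
    and ineq: "\<And>x y. f x ^ p * g y ^ q
      \<le> h ((1 / real (p + q)) *\<^sub>R (real p *\<^sub>R x + real q *\<^sub>R y)) ^ (p + q)"
  shows "(\<integral>\<^sup>+x. f x \<partial>lborel) ^ p * (\<integral>\<^sup>+x. g x \<partial>lborel) ^ q \<le> (\<integral>\<^sup>+x. h x \<partial>lborel) ^ (p + q)"
proof -
  let ?e = "\<lambda>x. \<Sum>b\<in>Basis. x b *\<^sub>R b :: 'a"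
  let ?P = "\<Pi>\<^sub>M b\<in>(Basis :: 'a set). (lborel :: real measure)"
  interpret product_sigma_finite "\<lambda>b :: 'a. lborel :: real measure" ..
  have [measurable]: "?e \<in> ?P \<rightarrow>\<^sub>M borel" by measurable
  have int: "(\<integral>\<^sup>+x. k x \<partial>lborel) = (\<integral>\<^sup>+x. k (?e x) \<partial>?P)"
    if [measurable]: "k \<in> borel_measurable borel" for k :: "'a \<Rightarrow> ennreal"
    unfolding lborel_def[where 'a = 'a] by (simp add: nn_integral_distr flip: lborel_eq_real)
  show ?thesis
    unfolding int[OF assms(1)] int[OF assms(2)] int[OF assms(3)]
  proof (rule prekopa_leindler_PiM)
    fix x y :: "'a \<Rightarrow> real"
    have "?e (\<lambda>b\<in>Basis. (real p * x b + real q * y b) / real (p + q))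
        = (1 / real (p + q)) *\<^sub>R (real p *\<^sub>R ?e x + real q *\<^sub>R ?e y)"
      by (simp add: scaleR_sum_right scaleR_add_left add_divide_distrib sum.distrib scaleR_add_right)
    then show "f (?e x) ^ p * g (?e y) ^ q
        \<le> h (?e (\<lambda>b\<in>Basis. (real p * x b + real q * y b) / real (p + q))) ^ (p + q)"
      using ineq by simp
  qed (use pq in auto)
qed

section \<open>Log-concavity of scaled power integrals\<close>

lemma log_concave_nonneg: "log_concave f \<Longrightarrow> 0 \<le> f x"
proof -
  assume "log_concave f"
  then obtain U where "ereal (f x) = exp_ereal (- U x)"
    unfolding log_concave_def by blast
  moreover have "0 \<le> exp_ereal a" for a by (cases a) simp_all
  ultimately show ?thesis by (metis ereal_less_eq(5))
qed

text \<open>The passage from \<^typ>\<open>ereal\<close>-valued potentials to an inequality between real numbers.\<close>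

lemma log_concave_powr:
  fixes f :: "'a::real_vector \<Rightarrow> real"
  assumes f: "log_concave f" and s: "0 < s" "s < 1"
  shows "f x powr (1 - s) * f y powr s \<le> f ((1 - s) *\<^sub>R x + s *\<^sub>R y)"
proof (cases "f x = 0 \<or> f y = 0")
  case True
  then show ?thesis using log_concave_nonneg[OF f] by auto
next
  case False
  obtain U where U: "\<And>z. U z \<noteq> -\<infinity>"
      "\<And>x y s. s \<in> {0..1} \<Longrightarrow> U ((1 - s) *\<^sub>R x + s *\<^sub>R y) \<le> ereal (1 - s) * U x + ereal s * U y"
      "\<And>z. ereal (f z) = exp_ereal (- U z)"
    using f unfolding log_concave_def convex_ereal_def by metis
  let ?z = "(1 - s) *\<^sub>R x + s *\<^sub>R y"
  have fin: "\<exists>r. U z = ereal r \<and> f z = exp (- r)" if "f z \<noteq> 0" for z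
    using that U(1,3)[of z] by (cases "U z") (auto simp: zero_ereal_def)
  obtain u v where u: "U x = ereal u" "f x = exp (- u)" and v: "U y = ereal v" "f y = exp (- v)"
    using fin False by blast
  have "U ?z \<le> ereal ((1 - s) * u + s * v)"
    using U(2)[of s x y] s u v by simp
  then obtain w where w: "U ?z = ereal w" "w \<le> (1 - s) * u + s * v"
    using U(1)[of ?z] by (cases "U ?z") auto
  have "f x powr (1 - s) * f y powr s = exp (- ((1 - s) * u + s * v))"
    using u v by (simp add: powr_def algebra_simps flip: exp_add)
  also have "\<dots> \<le> exp (- w)" using w by simp
  also have "exp (- w) = f ?z" using U(3)[of ?z] w by simp
  finally show ?thesis .
qed

lemma nn_integral_lborel_scale:
  fixes k :: "'a::euclidean_space \<Rightarrow> ennreal"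
  assumes [measurable]: "k \<in> borel_measurable borel" and a: "a > 0"
  shows "(\<integral>\<^sup>+x. k ((1 / a) *\<^sub>R x) \<partial>lborel) = ennreal (a ^ DIM('a)) * (\<integral>\<^sup>+x. k x \<partial>lborel)"
proof -
  have "(\<integral>\<^sup>+x. k ((1 / a) *\<^sub>R x) \<partial>lborel)
      = (\<integral>\<^sup>+x. k ((1 / a) *\<^sub>R x) \<partial>density (distr lborel borel (\<lambda>x :: 'a. 0 + a *\<^sub>R x)) (\<lambda>_. \<bar>a\<bar> ^ DIM('a)))"
    using lborel_affine[of a "0 :: 'a"] a by simp
  also have "\<dots> = (\<integral>\<^sup>+x. ennreal (a ^ DIM('a)) * k x \<partial>lborel)"
    using a by (subst nn_integral_density) (simp_all add: nn_integral_distr)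
  finally show ?thesis by (simp add: nn_integral_cmult)
qed

definition scaled_power_integral :: "('a::euclidean_space \<Rightarrow> real) \<Rightarrow> real \<Rightarrow> ennreal" where
  "scaled_power_integral f a = ennreal (a ^ DIM('a)) * (\<integral>\<^sup>+x. ennreal (f x powr a) \<partial>lborel)"

text \<open>The factor \<open>a\<^sup>n\<close> is absorbed by the substitution \<open>x = y / a\<close>. The hypothesis of
  Prekopa--Leindler is then the joint convexity of the perspective: the point \<open>z / c\<close> is the convex
  combination of \<open>x / a\<close> and \<open>y / b\<close> with weights proportional to \<open>p a\<close> and \<open>q b\<close>, and not to
  \<open>p\<close> and \<open>q\<close>.\<close>

lemma scaled_power_integral_log_concave:
  fixes f :: "'a::euclidean_space \<Rightarrow> real"
  assumes f: "log_concave f" and [measurable]: "f \<in> borel_measurable borel"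
    and ab: "0 < a" "0 < b" and pq: "0 < p" "0 < q"
    and c: "c = (real p * a + real q * b) / real (p + q)"
  shows "scaled_power_integral f a ^ p * scaled_power_integral f b ^ q \<le> scaled_power_integral f c ^ (p + q)"
proof -
  define d where "d = real p * a + real q * b"
  have d: "0 < d" "c * real (p + q) = d" using ab pq c by (auto simp: d_def add_pos_pos)
  have "0 < c" using d pq c by (simp add: d_def)
  have scaled: "scaled_power_integral f r = (\<integral>\<^sup>+x. ennreal (f ((1 / r) *\<^sub>R x) powr r) \<partial>lborel)" if "0 < r" for r
    unfolding scaled_power_integral_def by (rule nn_integral_lborel_scale[symmetric]) (use that in auto)
  show ?thesis
    unfolding scaled[OF ab(1)] scaled[OF ab(2)] scaled[OF \<open>0 < c\<close>]
  proof (rule prekopa_leindler)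
    fix x y :: 'a
    define s where "s = real q * b / d"
    have sd: "s * d = b * real q" using d(1) by (simp add: s_def)
    then have "(1 - s) * d = a * real p" by (simp add: left_diff_distrib d_def)
    moreover have "0 < s" "s < 1"
      using ab pq d(1) by (simp_all add: s_def) (simp add: d_def)
    ultimately have s: "0 < s" "s < 1" "(1 - s) * d = a * real p" "s * d = b * real q"
      using sd by auto
    let ?u = "(1 / a) *\<^sub>R x" and ?v = "(1 / b) *\<^sub>R y"
    let ?z = "(1 / c) *\<^sub>R (1 / real (p + q)) *\<^sub>R (real p *\<^sub>R x + real q *\<^sub>R y)"
    have "(1 - s) / a = real p / d" "s / b = real q / d"
      using s(3,4) d(1) ab by (simp_all add: field_simps)
    then have z: "(1 - s) *\<^sub>R ?u + s *\<^sub>R ?v = ?z"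
      using d by (simp add: scaleR_add_right)
    have powr_pow: "(r powr u) ^ k = r powr (u * real k)" if "0 < k" for r u :: real and k
      using that powr_realpow'[of "r powr u" k] by (simp add: powr_powr)
    have "(f ?u powr a) ^ p * (f ?v powr b) ^ q = f ?u powr (a * real p) * f ?v powr (b * real q)"
      using pq by (simp add: powr_pow)
    also have "\<dots> = (f ?u powr (1 - s) * f ?v powr s) powr d"
      by (simp add: powr_mult powr_powr s)
    also have "\<dots> \<le> f ((1 - s) *\<^sub>R ?u + s *\<^sub>R ?v) powr d"
      using d by (intro powr_mono2 log_concave_powr f s) auto
    also have "\<dots> = (f ?z powr c) ^ (p + q)"
      unfolding z using pq d(2) by (subst powr_pow) simp_all
    finally show "ennreal (f ?u powr a) ^ p * ennreal (f ?v powr b) ^ q \<le> ennreal (f ?z powr c) ^ (p + q)"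
      by (simp add: ennreal_power flip: ennreal_mult)
  qed (use pq in auto)
qed

text \<open>Both the Jensen bound and the Chernoff bound compare \<open>r powr a\<close> with \<open>r\<close> by estimating the last
  exponential. The identity is arranged with the factor \<open>r\<close> in front so that it covers \<open>r = 0\<close>,
  where \<open>ln r\<close> carries no information.\<close>

lemma powr_exponential_tilt:
  fixes r :: real
  assumes "0 \<le> r"
  shows "r powr a = exp ((1 - a) * k) * (r * exp ((a - 1) * (ln r + k)))"
proof (cases "r = 0")
  case False
  with assms have "exp ((1 - a) * k) * (r * exp ((a - 1) * (ln r + k)))
      = exp ((1 - a) * k + (ln r + (a - 1) * (ln r + k)))"
    by (simp only: exp_add) simp
  also have "\<dots> = r powr a" using False by (simp add: powr_def algebra_simps)
  finally show ?thesis ..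
qed simp

section \<open>Exponential moments of the information content\<close>

locale log_concave_density =
  fixes f :: "'a::euclidean_space \<Rightarrow> real"
  assumes log_concave: "log_concave f"
    and measurable_density [measurable]: "f \<in> borel_measurable borel"
    and total_mass: "(\<integral>\<^sup>+x. ennreal (f x) \<partial>lborel) = 1"
begin

lemma nonneg [simp]: "0 \<le> f x"
  using log_concave by (rule log_concave_nonneg)

definition power_integral :: "real \<Rightarrow> real" where
  "power_integral a = (\<integral>x. f x powr a \<partial>lborel)"

definition density_entropy :: real where
  "density_entropy = - (\<integral>x. f x * ln (f x) \<partial>lborel)"

lemma scaled_power_integral_1: "scaled_power_integral f 1 = 1"
  by (simp add: scaled_power_integral_def total_mass)

lemma scaled_power_integral_nonzero:
  assumes "0 < a"
  shows "scaled_power_integral f a \<noteq> 0"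
proof
  assume "scaled_power_integral f a = 0"
  then have "(\<integral>\<^sup>+x. ennreal (f x powr a) \<partial>lborel) = 0"
    using assms by (simp add: scaled_power_integral_def)
  then have "AE x in lborel. ennreal (f x) = 0"
    by (subst (asm) nn_integral_0_iff_AE) (auto simp: ennreal_eq_0_iff)
  then have "(\<integral>\<^sup>+x. ennreal (f x) \<partial>lborel) = 0"
    by (subst nn_integral_0_iff_AE) auto
  with total_mass show False by simp
qed

text \<open>The chord form of the tangent inequality at \<open>1\<close>: the second point lies at distance
  \<open>\<bar>1 - a\<bar> / m\<close> from \<open>1\<close> on the side opposite to \<open>a\<close>.\<close>

lemma scaled_power_integral_chord:
  assumes "0 < a" "0 < m" "a - 1 < real m"
  shows "scaled_power_integral f a * scaled_power_integral f (1 + (1 - a) / real m) ^ m \<le> 1"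
proof -
  have "real m * (1 + (1 - a) / real m) = real m + (1 - a)" "0 < 1 + (1 - a) / real m"
    using assms by (simp_all add: field_simps)
  then have "scaled_power_integral f a ^ 1 * scaled_power_integral f (1 + (1 - a) / real m) ^ m \<le> scaled_power_integral f 1 ^ (1 + m)"
    by (intro scaled_power_integral_log_concave[OF log_concave]) (use assms in simp_all)
  then show ?thesis by (simp add: scaled_power_integral_1)
qed

text \<open>If a log-concave function with positive values were infinite at \<open>a \<noteq> 1\<close>, it would be infinite at
  every point strictly between \<open>a\<close> and any other point, in particular at \<open>1\<close>.\<close>

lemma scaled_power_integral_finite:
  assumes "0 < a"
  shows "scaled_power_integral f a \<noteq> \<infinity>"
proof
  assume inf: "scaled_power_integral f a = \<infinity>"
  obtain m :: nat where m: "a < real m" using reals_Archimedean2 by blast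
  have "0 < 1 + (1 - a) / real m" using assms m by (simp add: field_simps)
  then have "scaled_power_integral f (1 + (1 - a) / real m) ^ m \<noteq> 0"
    using scaled_power_integral_nonzero by simp
  with scaled_power_integral_chord[OF assms, of m] m assms inf show False
    by (auto simp: ennreal_top_mult top_unique)
qed

lemma integrable_powr:
  assumes "0 < a"
  shows "integrable lborel (\<lambda>x. f x powr a)"
proof (rule integrableI_nonneg)
  show "(\<integral>\<^sup>+x. ennreal (f x powr a) \<partial>lborel) < \<infinity>"
    using scaled_power_integral_finite[OF assms] assms
    by (auto simp: scaled_power_integral_def ennreal_mult_eq_top_iff less_top)
qed auto

lemma power_integral_nonneg: "0 \<le> power_integral a"
  by (simp add: power_integral_def)

lemma scaled_power_integral_eq:
  assumes "0 < a"
  shows "scaled_power_integral f a = ennreal (a ^ DIM('a) * power_integral a)"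
  using assms integrable_powr[OF assms] power_integral_nonneg
  by (simp add: scaled_power_integral_def power_integral_def nn_integral_eq_integral ennreal_mult)

lemma integrable_density: "integrable lborel f"
  using integrable_powr[of 1] by simp

lemma integral_density: "(\<integral>x. f x \<partial>lborel) = 1"
  using total_mass by (simp add: integral_eq_nn_integral)

text \<open>The logarithm is dominated by a small negative power near \<open>0\<close> and by the identity near infinity, so
  the integrals of \<open>f powr (1 / 2)\<close> and \<open>f powr 2\<close> control the entropy integral.\<close>

lemma integrable_density_ln: "integrable lborel (\<lambda>x. f x * ln (f x))"
proof (rule Bochner_Integration.integrable_bound)
  show "integrable lborel (\<lambda>x. 2 * f x powr (1 / 2) + f x powr 2)"
    by (intro Bochner_Integration.integrable_add integrable_mult_right integrable_powr) auto
  have "\<bar>r * ln r\<bar> \<le> 2 * r powr (1 / 2) + r powr 2" if r: "0 \<le> r" for r :: real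
  proof (cases "r = 0")
    case False
    with r have pos: "0 < r" by simp
    have "r * ln r \<le> r * r"
      using pos ln_le_minus_one[OF pos] by (intro mult_left_mono) auto
    moreover have "- ln r \<le> 2 * r powr (- (1 / 2))"
      using ln_le_minus_one[of "r powr (- (1 / 2))"] pos by (simp add: ln_powr)
    then have "r * - ln r \<le> r * (2 * r powr (- (1 / 2)))"
      using r by (intro mult_left_mono)
    moreover have "r * r powr (- (1 / 2)) = r powr (1 / 2)"
      using pos powr_add[of r 1 "- (1 / 2)"] by simp
    moreover have "r * r = r powr 2" using pos by (simp add: powr_numeral power2_eq_square)
    ultimately show ?thesis
      using pos by (auto simp: abs_le_iff algebra_simps intro: add_increasing add_increasing2)
  qed simp
  then show "AE x in lborel. norm (f x * ln (f x)) \<le> norm (2 * f x powr (1 / 2) + f x powr 2)"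
    by (intro AE_I2) auto
qed auto

text \<open>Jensen's inequality for the exponential function under the density \<open>f\<close>, in the form of the tangent
  bound \<open>1 + x \<le> e\<^sup>x\<close> at the mean.\<close>

lemma power_integral_lower_bound:
  assumes "0 < a"
  shows "exp ((1 - a) * density_entropy) \<le> power_integral a"
proof -
  let ?L = "\<lambda>x. exp ((1 - a) * density_entropy) * ((1 + (a - 1) * density_entropy) * f x + (a - 1) * (f x * ln (f x)))"
  have "(\<integral>x. ?L x \<partial>lborel) = exp ((1 - a) * density_entropy) * ((1 + (a - 1) * density_entropy) * 1 + (a - 1) * (- density_entropy))"
    using integrable_density integrable_density_ln
    by (simp add: integral_density density_entropy_def)
  also have "\<dots> = exp ((1 - a) * density_entropy)" by simp
  finally have "exp ((1 - a) * density_entropy) = (\<integral>x. ?L x \<partial>lborel)" ..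
  also have "\<dots> \<le> power_integral a"
    unfolding power_integral_def
  proof (rule integral_mono)
    fix x
    have "(1 + (a - 1) * density_entropy) * f x + (a - 1) * (f x * ln (f x)) = f x * (1 + (a - 1) * (ln (f x) + density_entropy))"
      by (simp add: algebra_simps)
    also have "\<dots> \<le> f x * exp ((a - 1) * (ln (f x) + density_entropy))"
      by (intro mult_left_mono exp_ge_add_one_self) simp
    finally have "?L x \<le> exp ((1 - a) * density_entropy) * (f x * exp ((a - 1) * (ln (f x) + density_entropy)))"
      by simp
    also have "\<dots> = f x powr a"
      by (rule powr_exponential_tilt[symmetric]) simp
    finally show "?L x \<le> f x powr a" .
  qed (use integrable_density integrable_density_ln integrable_powr[OF assms] in auto)
  finally show ?thesis .
qed

text \<open>The chord inequality and Jensen's bound together give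
  \<open>a\<^sup>n (\<integral> f\<^sup>a) exp ((a - 1) h) (b\<^sup>m)\<^sup>n \<le> 1\<close> with \<open>b = 1 + (1 - a) / m\<close>, and \<open>b\<^sup>m\<close> tends to
  \<open>exp (1 - a)\<close>.\<close>

lemma power_integral_upper_bound:
  assumes a: "0 < a"
  shows "power_integral a \<le> exp ((a - 1) * (real DIM('a) - density_entropy)) / a ^ DIM('a)"
proof -
  let ?n = "DIM('a)"
  let ?b = "\<lambda>m::nat. 1 + (1 - a) / real m"
  let ?E = "a ^ ?n * power_integral a * exp ((a - 1) * density_entropy)"
  have "\<forall>\<^sub>F m in sequentially. ?E * (?b m ^ m) ^ ?n \<le> 1"
    using eventually_gt_at_top[of 0] eventually_ge_at_top[of "nat \<lceil>a\<rceil>"]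
  proof eventually_elim
    case (elim m)
    then have m: "0 < m" "a - 1 < real m" by linarith+
    then have b: "0 < ?b m" by (simp add: field_simps)
    let ?G = "a ^ ?n * power_integral a * (?b m ^ ?n * power_integral (?b m)) ^ m"
    have "(?b m ^ ?n * exp ((1 - ?b m) * density_entropy)) ^ m = (?b m ^ m) ^ ?n * exp ((1 - ?b m) * density_entropy) ^ m"
      by (simp only: power_mult_distrib mult.commute flip: power_mult)
    also have "exp ((1 - ?b m) * density_entropy) ^ m = exp ((a - 1) * density_entropy)"
      using m by (simp add: field_simps flip: exp_of_nat_mult)
    finally have "?E * (?b m ^ m) ^ ?n
        = a ^ ?n * power_integral a * (?b m ^ ?n * exp ((1 - ?b m) * density_entropy)) ^ m"
      by (simp only: mult_ac)
    also have "\<dots> \<le> ?G"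
      using a b power_integral_nonneg power_integral_lower_bound[OF b] by (intro mult_left_mono power_mono) auto
    also have "ennreal ?G = scaled_power_integral f a * scaled_power_integral f (?b m) ^ m"
      using a b power_integral_nonneg by (simp add: scaled_power_integral_eq ennreal_power flip: ennreal_mult)
    then have "?G \<le> 1"
      using scaled_power_integral_chord[OF a m] by (metis ennreal_le_1)
    finally show ?case .
  qed
  moreover have "(\<lambda>m. ?E * (?b m ^ m) ^ ?n) \<longlonglongrightarrow> ?E * exp (1 - a) ^ ?n"
    by (intro tendsto_intros tendsto_exp_limit_sequentially)
  ultimately have "?E * exp (1 - a) ^ ?n \<le> 1"
    by (intro tendsto_upperbound[of _ _ sequentially]) auto
  moreover have "exp ((a - 1) * (real ?n - density_entropy)) * (exp ((a - 1) * density_entropy) * exp (1 - a) ^ ?n) = 1"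
    by (simp flip: exp_add exp_of_nat_mult add: algebra_simps)
  ultimately have "a ^ ?n * power_integral a \<le> exp ((a - 1) * (real ?n - density_entropy))"
    by (smt (verit) mult.assoc mult.commute mult_le_cancel_left_pos exp_gt_zero mult_pos_pos zero_less_power)
  then show ?thesis using a by (simp add: field_simps)
qed

text \<open>Markov's inequality for \<open>exp ((1 - a) (- ln f - h - s))\<close>. Keeping the factor \<open>1 - a\<close> in the event
  treats both tails at once, because its sign selects the direction of the inequality.\<close>

lemma chernoff_bound:
  assumes a: "0 < a"
  shows "(\<integral>\<^sup>+x. ennreal (f x) * indicator {x. (1 - a) * (- ln (f x) - density_entropy) \<ge> (1 - a) * s} x \<partial>lborel)
    \<le> ennreal (exp ((a - 1) * (real DIM('a) + s)) / a ^ DIM('a))"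
proof -
  let ?A = "{x. (1 - a) * (- ln (f x) - density_entropy) \<ge> (1 - a) * s}"
  let ?k = "exp ((a - 1) * (density_entropy + s))"
  have "f x \<le> ?k * f x powr a" if "x \<in> ?A" for x
  proof -
    have "0 \<le> (a - 1) * (ln (f x) + (density_entropy + s))" using that by (simp add: algebra_simps)
    then have "f x * 1 \<le> f x * exp ((a - 1) * (ln (f x) + (density_entropy + s)))"
      by (intro mult_left_mono) auto
    also have "\<dots> = ?k * (exp ((1 - a) * (density_entropy + s)) * (f x * exp ((a - 1) * (ln (f x) + (density_entropy + s)))))"
    proof -
      have "?k * exp ((1 - a) * (density_entropy + s)) = 1" by (simp flip: exp_add add: algebra_simps)
      then show ?thesis by (simp flip: mult.assoc)
    qed
    also have "\<dots> = ?k * f x powr a"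
      by (subst powr_exponential_tilt[where k = "density_entropy + s"]) auto
    finally show ?thesis by simp
  qed
  then have "(\<integral>\<^sup>+x. ennreal (f x) * indicator ?A x \<partial>lborel) \<le> (\<integral>\<^sup>+x. ennreal (?k * f x powr a) \<partial>lborel)"
    by (intro nn_integral_mono) (auto simp: indicator_def split: if_splits)
  also have "\<dots> = ennreal (?k * power_integral a)"
    using integrable_powr[OF a] by (subst nn_integral_eq_integral) (auto simp: power_integral_def)
  also have "\<dots> \<le> ennreal (?k * (exp ((a - 1) * (real DIM('a) - density_entropy)) / a ^ DIM('a)))"
    by (intro ennreal_leI mult_left_mono power_integral_upper_bound a) simp
  also have "?k * (exp ((a - 1) * (real DIM('a) - density_entropy)) / a ^ DIM('a))
      = exp ((a - 1) * (real DIM('a) + s)) / a ^ DIM('a)"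
    by (simp flip: exp_add add: algebra_simps)
  finally show ?thesis .
qed

end

section \<open>Concentration of the information content\<close>

theorem corollary4p4:
  fixes M :: "'b measure" and X :: "'b \<Rightarrow> real ^ 'n" and f :: "real ^ 'n \<Rightarrow> real" and t :: real
  assumes "prob_space M"
    and "distributed M lborel X (\<lambda>x. ennreal (f x))"
    and "log_concave f"
    and "t > 0"
  shows "ereal (\<P>(\<omega> in M. info_content f (X \<omega>) - diff_entropy M X f \<le> - (real CARD('n) * t)))
             \<le> exp_ereal (- (ereal (real CARD('n)) * rate (- t)))
         \<and> ereal (\<P>(\<omega> in M. info_content f (X \<omega>) - diff_entropy M X f \<ge> real CARD('n) * t))
             \<le> exp_ereal (- (ereal (real CARD('n)) * rate t))"
proof -
  interpret prob_space M by fact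
  note X = assms(2)
  let ?n = "real CARD('n)" and ?h = "diff_entropy M X f"
  have nonneg: "0 \<le> f x" for x using assms(3) by (rule log_concave_nonneg)
  have f_meas [measurable]: "f \<in> borel_measurable borel"
    using distributed_real_measurable[OF _ X] nonneg by simp
  have [measurable]: "X \<in> M \<rightarrow>\<^sub>M borel"
    using distributed_measurable[OF X] by simp
  interpret log_concave_density f
  proof
    have "(\<integral>\<^sup>+x. ennreal (f x) * 1 \<partial>lborel) = (\<integral>\<^sup>+\<omega>. 1 \<partial>M)"
      by (rule distributed_nn_integral[OF X]) simp
    then show "(\<integral>\<^sup>+x. ennreal (f x) \<partial>lborel) = 1"
      by (simp add: emeasure_space_1)
  qed (use assms(3) f_meas in auto)
  have h: "?h = density_entropy" unfolding density_entropy_def by (rule diff_entropy_eq[OF X nonneg])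
  have tail: "\<P>(\<omega> in M. (1 - a) * (info_content f (X \<omega>) - ?h) \<ge> (1 - a) * s)
      \<le> exp ((a - 1) * (?n + s)) / a ^ CARD('n)" if a: "0 < a" for a s
  proof -
    let ?A = "{x. (1 - a) * (- ln (f x) - density_entropy) \<ge> (1 - a) * s}"
    have "{\<omega> \<in> space M. (1 - a) * (info_content f (X \<omega>) - ?h) \<ge> (1 - a) * s} = X -` ?A \<inter> space M"
      by (auto simp: info_content_def h)
    then have "emeasure M {\<omega> \<in> space M. (1 - a) * (info_content f (X \<omega>) - ?h) \<ge> (1 - a) * s}
        = (\<integral>\<^sup>+x. ennreal (f x) * indicator ?A x \<partial>lborel)"
      by (simp only:) (rule distributed_emeasure[OF X], measurable)
    also have "\<dots> \<le> ennreal (exp ((a - 1) * (?n + s)) / a ^ CARD('n))"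
      using chernoff_bound[OF a, of s] by simp
    finally show ?thesis
      using a by (simp add: emeasure_eq_measure)
  qed
  have optimal: "exp ((1 / (1 + u) - 1) * (?n + ?n * u)) / (1 / (1 + u)) ^ CARD('n)
      = exp (- (?n * (u - ln (1 + u))))" if u: "-1 < u" for u
  proof -
    have "(1 / (1 + u) - 1) * (?n + ?n * u) = - (?n * u)" using u by (simp add: field_simps)
    moreover have "exp (?n * ln (1 + u)) = (1 + u) ^ CARD('n)" using u by (simp add: exp_of_nat_mult)
    ultimately show ?thesis
      by (simp add: power_one_over right_diff_distrib exp_diff exp_minus field_simps)
  qed
  have upper: "ereal (\<P>(\<omega> in M. info_content f (X \<omega>) - ?h \<ge> ?n * t)) \<le> exp_ereal (- (ereal ?n * rate t))"
  proof -
    have "0 < 1 - 1 / (1 + t)" using assms(4) by simp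
    then show ?thesis
      using tail[of "1 / (1 + t)" "?n * t"] optimal[of t] assms(4) by (simp add: rate_def)
  qed
  have lower: "ereal (\<P>(\<omega> in M. info_content f (X \<omega>) - ?h \<le> - (?n * t))) \<le> exp_ereal (- (ereal ?n * rate (- t)))"
  proof (cases "t < 1")
    case True
    then have "1 - 1 / (1 - t) < 0" using assms(4) by simp
    note event = mult_le_cancel_left_neg[OF this]
    show ?thesis
      using tail[of "1 / (1 - t)" "- (?n * t)", unfolded event] optimal[of "- t"] True by (simp add: rate_def)
  next
    case False
    let ?P = "\<P>(\<omega> in M. info_content f (X \<omega>) - ?h \<le> - (?n * t))"
    \<comment> \<open>Every \<open>a > 1\<close> gives a nonpositive exponent here, so \<open>1 / a\<close> bounds the probability.\<close>
    have "\<forall>\<^sub>F a in at_top. ?P \<le> 1 / a"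
      using eventually_gt_at_top[of "1 :: real"]
    proof eventually_elim
      case (elim a)
      then have "1 - a < 0" by simp
      note event = mult_le_cancel_left_neg[OF this]
      have "?P \<le> exp ((a - 1) * (?n + - (?n * t))) / a ^ CARD('n)"
        using tail[of a "- (?n * t)", unfolded event] elim by simp
      also have "(a - 1) * (?n + - (?n * t)) \<le> 0"
        using False elim by (simp add: mult_le_0_iff)
      then have "exp ((a - 1) * (?n + - (?n * t))) / a ^ CARD('n) \<le> 1 / a ^ CARD('n)"
        using elim by (intro divide_right_mono) auto
      also have "1 / a ^ CARD('n) \<le> 1 / a"
        using elim by (intro divide_left_mono self_le_power) auto
      finally show ?case .
    qed
    moreover have "((\<lambda>a::real. 1 / a) \<longlongrightarrow> 0) at_top"
      by (simp add: divide_inverse tendsto_inverse_0_at_top filterlim_ident)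
    ultimately have "?P \<le> 0"
      by (intro tendsto_lowerbound[of _ _ at_top]) auto
    then show ?thesis using False by (simp add: rate_def)
  qed
  from lower upper show ?thesis ..
qed

end
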